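(* Let $R:[0,\infty)\to SO(3)$ and $\Omega:[0,\infty)\to\mathbb R^3$ satisfy the rigid body kinematic equation $\dot R = R\hat\Omega$, and assume that $\Omega$ is bounded on $[0,\infty)$. Let $b\in\mathbb R^3$ be a constant vector and set $\Omega_{\rm m}(t)=\Omega(t)+b$. Let $F\in\mathbb R^{3\times 3}$ be a constant invertible matrix and set $A(t)=F R(t)$. Then for any $k_P>0$ and $k_I>0$ there exist numbers $a>0$ and $C>0$ such that for every $(\bar A(0),\bar b(0))\in\mathbb R^{3\times 3}\times\mathbb R^3$, the solution $(\bar A(t),\bar b(t))\in\mathbb R^{3\times 3}\times\mathbb R^3$ of $$\dot{\bar A} = \bar A\,\hat\Omega_{\rm m} - A\,\hat{\bar b} + k_P(A-\bar A),\qquad \dot{\bar b} = k_I\,\mathrm{Skew}(A^T\bar A)^\vee$$ with this initial condition satisfies, with $E_A = A-\bar A$ and $e_b=b-\bar b$, $$\|E_A(t)\|+\|e_b(t)\|\le C\,\big(\|E_A(0)\|+\|e_b(0)\|\big)\,e^{-at}\qquad\text{for all } t\ge 0.$$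
   Context: $SO(3)=\{R\in\mathbb R^{3\times3}\mid R^TR=I,\ \det R=1\}$ and $\mathfrak{so}(3)=\{M\in\mathbb R^{3\times 3}\mid M^T+M=0\}$. The hat map $\wedge:\mathbb R^3\to\mathfrak{so}(3)$ is $$\hat x=\begin{bmatrix}0&-x_3&x_2\\ x_3&0&-x_1\\ -x_2&x_1&0\end{bmatrix},\quad x=(x_1,x_2,x_3),$$ and the vee map $\vee:\mathfrak{so}(3)\to\mathbb R^3$ is its inverse. For a square matrix $M$, $\mathrm{Skew}(M)=\tfrac12(M-M^T)$. The norm $\|\cdot\|$ is the Euclidean norm on vectors and the Frobenius norm on matrices, i.e. the norm induced by $\langle M,N\rangle=\operatorname{tr}(M^TN)$. A dot denotes the time derivative. The constants $a$ and $C$ do not depend on $t$ or on the observer's initial condition $(\bar A(0),\bar b(0))$. *)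

theory Defs
  imports "HOL-Analysis.Analysis"
begin

definition SO3 :: "(real^3^3) set" where
  "SO3 = {R. transpose R ** R = mat 1 \<and> det R = 1}"

definition so3 :: "(real^3^3) set" where
  "so3 = {M. transpose M + M = 0}"

definition hat :: "real^3 \<Rightarrow> real^3^3" where
  "hat x = vector [vector [0, - x$3, x$2],
                   vector [x$3, 0, - x$1],
                   vector [- x$2, x$1, 0]]"

lemma hat_nth [simp]:
  "hat x $ 1 $ 1 = 0" "hat x $ 1 $ 2 = - x$3" "hat x $ 1 $ 3 = x$2"
  "hat x $ 2 $ 1 = x$3" "hat x $ 2 $ 2 = 0" "hat x $ 2 $ 3 = - x$1"
  "hat x $ 3 $ 1 = - x$2" "hat x $ 3 $ 2 = x$1" "hat x $ 3 $ 3 = 0"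
  by (simp_all add: hat_def)

lemma bij_betw_hat: "bij_betw hat UNIV so3"
proof (rule bij_betwI')
  fix x y :: "real^3"
  show "hat x = hat y \<longleftrightarrow> x = y"
  proof
    assume "hat x = hat y"
    then have "hat x $ i $ j = hat y $ i $ j" for i j by simp
    from this[of 3 2] this[of 1 3] this[of 2 1] show "x = y"
      by (simp add: vec_eq_iff forall_3)
  qed simp
next
  fix x :: "real^3"
  show "hat x \<in> so3"
    by (simp add: so3_def vec_eq_iff forall_3 transpose_def)
next
  fix M assume "M \<in> so3"
  then have *: "M$j$i + M$i$j = 0" for i j
    by (simp add: so3_def vec_eq_iff transpose_def)
  have "M$1$1 = 0" "M$2$2 = 0" "M$3$3 = 0" "M$2$3 = - M$3$2" "M$1$2 = - M$2$1" "M$3$1 = - M$1$3"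
    using *[of 1 1] *[of 2 2] *[of 3 3] *[of 2 3] *[of 1 2] *[of 3 1] by linarith+
  then have "M = hat (vector [M$3$2, M$1$3, M$2$1])"
    by (simp add: vec_eq_iff forall_3)
  then show "\<exists>x\<in>UNIV. M = hat x" by blast
qed

text \<open>Outside \<open>so3\<close> the value of \<open>vee\<close> is unspecified.\<close>

definition vee :: "real^3^3 \<Rightarrow> real^3" where
  "vee = inv_into UNIV hat"

lemma vee_hat [simp]: "vee (hat x) = x"
  using bij_betw_hat by (simp add: vee_def bij_betw_def)

lemma hat_vee: "M \<in> so3 \<Longrightarrow> hat (vee M) = M"
  using bij_betw_hat by (simp add: vee_def bij_betw_def f_inv_into_f)

definition Skew :: "real^'n^'n \<Rightarrow> real^'n^'n" where
  "Skew M = (1/2) *\<^sub>R (M - transpose M)"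

lemma Skew_in_so3: "Skew M \<in> so3"
  by (simp add: so3_def Skew_def vec_eq_iff transpose_def diff_divide_distrib)

text \<open>The library norm on \<^typ>\<open>real^3^3\<close> is the Frobenius norm.\<close>

lemma norm_matrix_Frobenius:
  fixes M :: "real^3^3"
  shows "norm M = sqrt (trace (transpose M ** M))"
  by (simp add: norm_eq_sqrt_inner inner_vec_def trace_def matrix_matrix_mult_def
      transpose_def sum_3 algebra_simps)

text \<open>Derivatives are taken within \<open>{0..}\<close>, hence one-sided at \<open>0\<close>; values at
  negative times are irrelevant.\<close>

definition rigid_body_kinematics :: "(real \<Rightarrow> real^3^3) \<Rightarrow> (real \<Rightarrow> real^3) \<Rightarrow> bool" where
  "rigid_body_kinematics R \<Omega> \<longleftrightarrow>
     (\<forall>t\<ge>0. R t \<in> SO3) \<and>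
     (\<forall>t\<ge>0. (R has_vector_derivative R t ** hat (\<Omega> t)) (at t within {0..}))"

definition observer_solution ::
  "real \<Rightarrow> real \<Rightarrow> (real \<Rightarrow> real^3^3) \<Rightarrow> (real \<Rightarrow> real^3) \<Rightarrow>
   (real \<Rightarrow> real^3^3) \<Rightarrow> (real \<Rightarrow> real^3) \<Rightarrow> bool" where
  "observer_solution kP kI A \<Omega>m Abar bbar \<longleftrightarrow>
     (\<forall>t\<ge>0. (Abar has_vector_derivative
        Abar t ** hat (\<Omega>m t) - A t ** hat (bbar t) + kP *\<^sub>R (A t - Abar t)) (at t within {0..})) \<and>
     (\<forall>t\<ge>0. (bbar has_vector_derivative
        kI *\<^sub>R vee (Skew (transpose (A t) ** Abar t))) (at t within {0..}))"

end

theory Submission imports Defs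
begin

text \<open>The quadratic form \<open>V = kI/2 |E|\<^sup>2 + |e|\<^sup>2\<close> of the errors \<open>E = A - Abar\<close>,
  \<open>e = b - bbar\<close> only satisfies \<open>V' = - kP kI |E|\<^sup>2\<close>. Adding a small multiple of
  \<open>\<langle>E, A hat e\<rangle>\<close> makes it a strict Lyapunov function: the derivative of this cross term contains
  \<open>- |A hat e|\<^sup>2\<close>, which dominates \<open>|e|\<^sup>2\<close> because \<open>F\<close> is invertible, and its remaining terms
  are \<open>O(|E| |e| + |E|\<^sup>2)\<close> because \<open>\<Omega>\<close> is bounded.\<close>

section \<open>Algebra of \<open>hat\<close>, \<open>vee\<close> and \<open>Skew\<close>\<close>

lemma vee_Skew_nth:
  fixes M :: "real^3^3"
  shows "vee (Skew M) $ 1 = (M $ 3 $ 2 - M $ 2 $ 3) / 2"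
    "vee (Skew M) $ 2 = (M $ 1 $ 3 - M $ 3 $ 1) / 2"
    "vee (Skew M) $ 3 = (M $ 2 $ 1 - M $ 1 $ 2) / 2"
proof -
  have "hat (vee (Skew M)) = Skew M" by (rule hat_vee[OF Skew_in_so3])
  then have "hat (vee (Skew M)) $ i $ j = (M $ i $ j - M $ j $ i) / 2" for i j
    by (simp add: Skew_def transpose_def)
  from this[of 3 2] this[of 1 3] this[of 2 1]
  show "vee (Skew M) $ 1 = (M $ 3 $ 2 - M $ 2 $ 3) / 2"
    "vee (Skew M) $ 2 = (M $ 1 $ 3 - M $ 3 $ 1) / 2"
    "vee (Skew M) $ 3 = (M $ 2 $ 1 - M $ 1 $ 2) / 2"
    by simp_all
qed

lemma linear_hat: "linear hat"
  by (rule linearI) (simp_all add: vec_eq_iff forall_3)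

lemma linear_vee_Skew: "linear (\<lambda>M::real^3^3. vee (Skew M))"
  by (rule linearI) (simp_all add: vec_eq_iff forall_3 vee_Skew_nth field_simps)

text \<open>Since \<open>hat x\<close> is antisymmetric, only the antisymmetric part of
  \<open>M\<close> contributes, and each coordinate of \<open>x\<close> occurs twice. This
  adjointness makes the coupling terms between \<open>E\<close> and \<open>e\<close> cancel in
  \<open>V'\<close>.\<close>

lemma inner_hat_eq_vee_Skew:
  fixes M :: "real^3^3"
  shows "inner M (hat x) = 2 * inner (vee (Skew M)) x"
  by (simp add: inner_vec_def sum_3 vee_Skew_nth field_simps)

lemma norm_hat: "norm (hat x) = sqrt 2 * norm x"
  by (simp add: norm_eq_sqrt_inner inner_vec_def sum_3 flip: real_sqrt_mult)

lemma inner_matrix_mult_left: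
  fixes X Y Z :: "real^3^3"
  shows "inner X (Y ** Z) = inner (transpose Y ** X) Z"
  by (simp add: inner_vec_def matrix_matrix_mult_def transpose_def sum_3 algebra_simps)

text \<open>The value is the inner product of the symmetric matrix \<open>transpose X ** X\<close>
  with an antisymmetric one. It removes the angular velocity from the derivative of
  \<open>|E|^2\<close>.\<close>

lemma inner_mult_hat_self:
  fixes X :: "real^3^3"
  shows "inner X (X ** hat w) = 0"
  by (simp add: inner_vec_def matrix_matrix_mult_def sum_3 algebra_simps)

text \<open>Cauchy-Schwarz in the adjoint identity with \<open>x = vee (Skew M)\<close>. This would
  give the factor \<open>1 / sqrt 2\<close>; it is rounded up to 1.\<close>

lemma norm_vee_Skew_le:
  fixes M :: "real^3^3"
  shows "norm (vee (Skew M)) \<le> norm M"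
proof -
  let ?s = "vee (Skew M)"
  have "2 * norm ?s ^ 2 = inner M (hat ?s)"
    by (simp add: inner_hat_eq_vee_Skew power2_norm_eq_inner)
  also have "\<dots> \<le> norm M * (sqrt 2 * norm ?s)"
    using norm_cauchy_schwarz[of M "hat ?s"] by (simp add: norm_hat)
  also have "\<dots> \<le> norm M * (2 * norm ?s)"
    by (intro mult_left_mono mult_right_mono) (auto simp: real_le_lsqrt sqrt2_less_2 less_imp_le)
  finally show ?thesis by (cases "norm ?s = 0") (auto simp: power2_eq_square)
qed

section \<open>Frobenius norm and matrix products\<close>

text \<open>Cauchy-Schwarz bounds each entry of the product by a row norm of \<open>X\<close> times
  a column norm of \<open>Y\<close>; the double sum of these bounds factors.\<close>

lemma norm_matrix_mult_le:
  fixes X :: "real^'n^'m" and Y :: "real^'k^'n"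
  shows "norm (X ** Y) \<le> norm X * norm Y"
proof -
  have F: "norm Z ^ 2 = (\<Sum>i\<in>UNIV. \<Sum>j\<in>UNIV. (Z $ i $ j) ^ 2)" for Z :: "real^'b^'a"
    unfolding power2_norm_eq_inner inner_vec_def by (simp add: power2_eq_square)
  have "norm (X ** Y) ^ 2
      = (\<Sum>i\<in>UNIV. \<Sum>j\<in>UNIV. (\<Sum>k\<in>UNIV. X $ i $ k * Y $ k $ j) ^ 2)"
    by (simp add: F matrix_matrix_mult_def)
  also have "\<dots> \<le> (\<Sum>i\<in>UNIV. \<Sum>j\<in>UNIV. (\<Sum>k\<in>UNIV. (X $ i $ k)^2) * (\<Sum>k\<in>UNIV. (Y $ k $ j)^2))"
    by (intro sum_mono Cauchy_Schwarz_ineq_sum)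
  also have "\<dots> = (\<Sum>i\<in>UNIV. \<Sum>k\<in>UNIV. (X $ i $ k)^2) * (\<Sum>j\<in>UNIV. \<Sum>k\<in>UNIV. (Y $ k $ j)^2)"
    by (simp add: sum_product)
  also have "(\<Sum>j\<in>UNIV. \<Sum>k\<in>UNIV. (Y $ k $ j)^2) = norm Y ^ 2"
    unfolding F by (rule sum.swap)
  also have "(\<Sum>i\<in>UNIV. \<Sum>k\<in>UNIV. (X $ i $ k)^2) = norm X ^ 2"
    unfolding F ..
  finally have "norm (X ** Y) ^ 2 \<le> (norm X * norm Y) ^ 2"
    by (simp add: power_mult_distrib)
  then show ?thesis by (rule power2_le_imp_le) simp
qed

text \<open>Supplies continuity, the product rule and distributivity for matrix products.\<close>

lemma bounded_bilinear_matrix_mult: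
  "bounded_bilinear ((**) :: real^'n^'m \<Rightarrow> real^'k^'n \<Rightarrow> real^'k^'m)"
proof
  show "\<exists>K. \<forall>(X::real^'n^'m) (Y::real^'k^'n). norm (X ** Y) \<le> norm X * norm Y * K"
    by (rule exI[of _ 1]) (simp add: norm_matrix_mult_le)
qed (simp_all add: vec_eq_iff matrix_matrix_mult_def algebra_simps sum.distrib sum_distrib_left)

lemma norm_transpose: "norm (transpose X) = norm (X::real^'n^'m)"
  unfolding norm_eq_sqrt_inner inner_vec_def transpose_def by simp (rule sum.swap)

section \<open>Exponential decay from a differential inequality\<close>

text \<open>The function \<open>W s * exp (c * s)\<close> has nonpositive derivative, hence does not
  increase.\<close>

lemma decay_from_derivative_bound:
  fixes W :: "real \<Rightarrow> real"
  assumes W: "\<And>t. 0 \<le> t \<Longrightarrow> (W has_real_derivative W' t) (at t within {0..})"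
    and le: "\<And>t. 0 \<le> t \<Longrightarrow> W' t \<le> - c * W t"
    and t: "0 \<le> t"
  shows "W t \<le> W 0 * exp (- c * t)"
proof -
  let ?g = "\<lambda>s. W s * exp (c * s)"
  \<comment> \<open>At interior points the one-sided derivative is two-sided; at 0 continuity is
    enough for the monotonicity argument.\<close>
  have dW: "(W has_real_derivative W' s) (at s)" if "0 < s" for s
    using W[of s] that at_within_open_subset[of s "{0<..}" "{0..}"] by force
  have "?g t \<le> ?g 0"
  proof (rule DERIV_nonpos_imp_decreasing_open[OF t])
    fix s assume s: "0 < s" "s < t"
    have "(?g has_real_derivative W' s * exp (c * s) + W s * (exp (c * s) * c)) (at s)"
      by (auto intro!: derivative_eq_intros dW s simp: algebra_simps)
    moreover have "W' s * exp (c * s) + W s * (exp (c * s) * c) = (W' s + c * W s) * exp (c * s)"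
      by (simp add: algebra_simps)
    moreover have "\<dots> \<le> 0"
      using le[of s] s by (intro mult_nonpos_nonneg) auto
    ultimately show "\<exists>y. (?g has_real_derivative y) (at s) \<and> y \<le> 0" by metis
  next
    have "continuous_on {0..} W"
      by (meson W DERIV_continuous atLeast_iff continuous_on_eq_continuous_within)
    then show "continuous_on {0..t} ?g"
      by (intro continuous_intros) (auto intro: continuous_on_subset)
  qed
  then have "W t * exp (c * t) * exp (- c * t) \<le> W 0 * exp (- c * t)"
    by (intro mult_right_mono) auto
  then show ?thesis by (simp add: mult.assoc flip: exp_add)
qed

section \<open>Global solutions of Lipschitz differential equations\<close>

text \<open>Differentiability at \<open>t\<close> is local, so the compact interval
  \<open>{c..t+1}\<close> can stand in for the half-line.\<close>

lemma has_vector_derivative_integral_atLeast: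
  fixes h :: "real \<Rightarrow> 'a::banach"
  assumes "continuous_on {c..} h" and "c \<le> t"
  shows "((\<lambda>u. integral {c..u} h) has_vector_derivative h t) (at t within {c..})"
proof -
  have "((\<lambda>u. integral {c..u} h) has_vector_derivative h t) (at t within {c..t+1})"
    using assms
    by (intro integral_has_vector_derivative) (auto intro: continuous_on_subset)
  moreover have "at t within {c..} = at t within {c..t+1}"
    by (rule at_within_nhd[of t "{t-1<..<t+1}"]) (use assms in auto)
  ultimately show ?thesis by simp
qed

text \<open>The integrand is the derivative of \<open>exp (2 * L * s)\<close>. Its multiples serve
  as majorants in the Picard estimates.\<close>

lemma exp_weight_integral:
  fixes L t :: real
  assumes "0 \<le> t"
  shows "((\<lambda>s. 2 * L * exp (2 * L * s)) has_integral (exp (2 * L * t) - 1)) {0..t}"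
proof -
  have "((\<lambda>s. 2 * L * exp (2 * L * s)) has_integral (exp (2 * L * t) - exp (2 * L * 0))) {0..t}"
    by (rule fundamental_theorem_of_calculus[OF assms])
      (auto intro!: derivative_eq_intros simp flip: has_real_derivative_iff_has_vector_derivative)
  then show ?thesis by simp
qed

text \<open>The Picard operator, conjugated by the weight \<open>exp (2 * L * t)\<close>, contracts bounded
  continuous functions by the factor \<open>1/2\<close>; so no continuation argument is needed.\<close>

lemma global_lipschitz_ode_solution:
  fixes f :: "real \<Rightarrow> 'a::banach \<Rightarrow> 'a" and x0 :: 'a
  assumes cont: "continuous_on ({0..} \<times> UNIV) (\<lambda>(t, x). f t x)"
    and lip: "\<And>t x y. 0 \<le> t \<Longrightarrow> norm (f t x - f t y) \<le> L * norm (x - y)"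
    and bdd: "\<And>t. 0 \<le> t \<Longrightarrow> norm (f t 0) \<le> K"
    and L: "0 < L"
  obtains x where "x 0 = x0"
    and "\<And>t. 0 \<le> t \<Longrightarrow> (x has_vector_derivative f t (x t)) (at t within {0..})"
proof -
  \<comment> \<open>With \<open>x s = exp (2 * L * s) *\<^sub>R y s\<close>, the integral equation
    for \<open>x\<close> reads \<open>y = P y\<close> on nonnegative times. The
    \<open>max 0 t\<close> extends \<open>P y\<close> constantly to negative times, because bounded
    continuous functions here live on the whole real line.\<close>
  define h where "h y s = f s (exp (2 * L * s) *\<^sub>R y s)" for y :: "real \<Rightarrow> 'a" and s
  define P where "P y t = exp (- 2 * L * max 0 t) *\<^sub>R (x0 + integral {0..max 0 t} (h y))"
    for y :: "real \<Rightarrow> 'a" and t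
  have K: "0 \<le> K" using order_trans[OF norm_ge_zero bdd[of 0]] by simp
  have conth: "continuous_on {0..} (h y)" if "continuous_on {0..} y" for y
  proof -
    have "continuous_on {0..} (\<lambda>s. (\<lambda>(t, x). f t x) (s, exp (2 * L * s) *\<^sub>R y s))"
      by (rule continuous_on_compose2[OF cont]) (auto intro!: continuous_intros that)
    then show ?thesis by (simp add: h_def[abs_def])
  qed
  have intble: "h y integrable_on {0..t}" if "continuous_on {0..} y" for y t
    by (rule integrable_continuous_real, rule continuous_on_subset[OF conth[OF that]]) auto
  have contI: "continuous_on {0..} (\<lambda>t. integral {0..t} (h y))" if "continuous_on {0..} y" for y
    using has_vector_derivative_integral_atLeast[OF conth[OF that]]
    by (meson atLeast_iff continuous_on_eq_continuous_within has_vector_derivative_continuous)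
  \<comment> \<open>A majorant \<open>c * (2 * L * exp (2 * L * s))\<close> contributes at most
    \<open>c\<close> after division by the weight, uniformly in \<open>t\<close>.\<close>
  have weighted: "exp (- 2 * L * t) * integral {0..t} (\<lambda>s. c * (2 * L * exp (2 * L * s))) \<le> c"
    if "0 \<le> t" "0 \<le> c" for c t
  proof -
    have I: "integral {0..t} (\<lambda>s. c * (2 * L * exp (2 * L * s))) = c * (exp (2 * L * t) - 1)"
      using exp_weight_integral[OF that(1), THEN has_integral_mult_right] by (rule integral_unique)
    have "exp (- 2 * L * t) * integral {0..t} (\<lambda>s. c * (2 * L * exp (2 * L * s)))
        = c * (1 - exp (- 2 * L * t))"
      unfolding I by (simp add: algebra_simps flip: exp_add)
    also have "\<dots> \<le> c * 1" by (rule mult_left_mono) (use that in auto)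
    finally show ?thesis by simp
  qed
  have wint: "(\<lambda>s. c * (2 * L * exp (2 * L * s))) integrable_on {0..t}" for c t
    by (intro integrable_continuous_real continuous_intros)
  have Pbcont: "P y \<in> bcontfun" if y: "y \<in> bcontfun" for y
  proof -
    have cy: "continuous_on {0..} y"
      using y by (auto simp: bcontfun_def intro: continuous_on_subset)
    obtain B where B: "\<And>t. norm (y t) \<le> B"
      using y by (auto simp: bcontfun_def bounded_iff)
    have B0: "0 \<le> B" using order_trans[OF norm_ge_zero B] .
    \<comment> \<open>Chosen so that \<open>c * 2 * L = K + L * B\<close>; the bound
      \<open>K\<close> at the zero state is absorbed through
      \<open>1 \<le> exp (2 * L * s)\<close>.\<close>
    define c where "c = (K / L + B) / 2"
    have c0: "0 \<le> c" using K L B0 by (simp add: c_def)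
    have contP: "continuous_on UNIV (P y)"
    proof -
      have "continuous_on UNIV (\<lambda>t. integral {0..max 0 t} (h y))"
        by (rule continuous_on_compose2[OF contI[OF cy], of _ "max 0"])
          (auto intro!: continuous_intros)
      then show ?thesis unfolding P_def[abs_def] by (intro continuous_intros)
    qed
    have "norm (P y t) \<le> norm x0 + c" for t
    proof -
      define u where "u = max 0 t"
      have u: "0 \<le> u" by (simp add: u_def)
      have hb: "norm (h y s) \<le> c * (2 * L * exp (2 * L * s))" if "s \<in> {0..u}" for s
      proof -
        have s: "0 \<le> s" using that by simp
        have "norm (h y s) \<le> norm (f s 0) + norm (h y s - f s 0)"
          by (metis add.commute diff_add_cancel norm_triangle_ineq)
        also have "\<dots> \<le> K + L * norm (exp (2 * L * s) *\<^sub>R y s - 0)"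
          unfolding h_def by (intro add_mono bdd lip s)
        also have "\<dots> \<le> K * exp (2 * L * s) + L * (exp (2 * L * s) * B)"
          using B[of s] K L s by (intro add_mono mult_left_mono) (auto simp: mult_le_cancel_left1)
        also have "\<dots> = c * (2 * L * exp (2 * L * s))"
          using L by (simp add: c_def field_simps)
        finally show ?thesis .
      qed
      have "norm (integral {0..u} (h y)) \<le> integral {0..u} (\<lambda>s. c * (2 * L * exp (2 * L * s)))"
        by (rule integral_norm_bound_integral[OF intble[OF cy] wint hb])
      then have "exp (- 2 * L * u) * norm (integral {0..u} (h y)) \<le> c"
        using weighted[OF u c0] by (smt (verit) mult_left_mono exp_ge_zero)
      moreover have "exp (- 2 * L * u) * norm x0 \<le> 1 * norm x0"
        using L u by (intro mult_right_mono) auto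
      moreover have "norm (P y t) \<le> exp (- 2 * L * u) * (norm x0 + norm (integral {0..u} (h y)))"
        unfolding P_def u_def[symmetric] norm_scaleR
        by (intro mult_mono norm_triangle_ineq) auto
      ultimately show ?thesis by (simp add: algebra_simps)
    qed
    with contP show ?thesis by (auto intro: bcontfun_normI)
  qed
  define T where "T z = Bcontfun (P (apply_bcontfun z))" for z :: "real \<Rightarrow>\<^sub>C 'a"
  have T: "apply_bcontfun (T z) = P (apply_bcontfun z)" for z
    unfolding T_def by (rule Bcontfun_inverse[OF Pbcont[OF apply_bcontfun]])
  have "dist (T y) (T z) \<le> 1/2 * dist y z" for y z
  proof (rule dist_bound)
    fix t :: real
    define u where "u = max 0 t"
    \<comment> \<open>The Lipschitz bound \<open>L * exp (2 * L * s) * dist y z\<close> is this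
      \<open>c\<close> times the standard majorant; the 2 in the exponent is what yields the
      contraction factor 1/2.\<close>
    define c where "c = dist y z / 2"
    have u: "0 \<le> u" and c0: "0 \<le> c" by (auto simp: u_def c_def)
    have cy: "continuous_on {0..} (apply_bcontfun y)" and cz: "continuous_on {0..} (apply_bcontfun z)"
      by auto
    have hb: "norm (h y s - h z s) \<le> c * (2 * L * exp (2 * L * s))" if "s \<in> {0..u}" for s
    proof -
      have "norm (h y s - h z s) \<le> L * norm (exp (2 * L * s) *\<^sub>R y s - exp (2 * L * s) *\<^sub>R z s)"
        unfolding h_def using that by (intro lip) auto
      also have "\<dots> = L * (exp (2 * L * s) * dist (y s) (z s))"
        by (simp add: dist_norm flip: scaleR_diff_right)
      also have "\<dots> \<le> L * (exp (2 * L * s) * dist y z)"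
        using L by (intro mult_left_mono dist_bounded) auto
      finally show ?thesis by (simp add: c_def mult_ac)
    qed
    have "dist (T y t) (T z t) = exp (- 2 * L * u) * norm (integral {0..u} (\<lambda>s. h y s - h z s))"
      unfolding T P_def u_def[symmetric] dist_norm
      by (simp add: integral_diff[OF intble[OF cy] intble[OF cz]] flip: scaleR_diff_right)
    also have "\<dots> \<le> exp (- 2 * L * u) * integral {0..u} (\<lambda>s. c * (2 * L * exp (2 * L * s)))"
      by (intro mult_left_mono integral_norm_bound_integral[OF _ wint hb]
          integrable_diff intble cy cz) auto
    also have "\<dots> \<le> c" by (rule weighted[OF u c0])
    finally show "dist (T y t) (T z t) \<le> 1/2 * dist y z" by (simp add: c_def)
  qed
  then obtain y where "T y = y"
    using banach_fix_type[of "1/2" T] by auto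
  then have yP: "y t = P y t" for t by (metis T)
  \<comment> \<open>Undoing the weight: the fixed point satisfies
    \<open>y t = exp (- 2 * L * t) *\<^sub>R x t\<close>, so the two exponentials in
    \<open>h y t\<close> cancel.\<close>
  define x where "x t = x0 + integral {0..t} (h y)" for t
  have hx: "h y t = f t (x t)" if "0 \<le> t" for t
    unfolding h_def yP[of t] unfolding P_def x_def using that by (simp flip: exp_add)
  show ?thesis
  proof
    show "x 0 = x0" by (simp add: x_def)
    fix t :: real assume t: "0 \<le> t"
    have "(x has_vector_derivative 0 + h y t) (at t within {0..})"
      unfolding x_def[abs_def]
      by (intro has_vector_derivative_add has_vector_derivative_const
          has_vector_derivative_integral_atLeast conth t) auto
    then show "(x has_vector_derivative f t (x t)) (at t within {0..})"
      by (simp add: hx[OF t])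
  qed
qed

section \<open>Existence of observer trajectories\<close>

lemmas matrix_mult_bilinear_simps =
  bounded_bilinear.add_left[OF bounded_bilinear_matrix_mult]
  bounded_bilinear.add_right[OF bounded_bilinear_matrix_mult]
  bounded_bilinear.diff_left[OF bounded_bilinear_matrix_mult]
  bounded_bilinear.diff_right[OF bounded_bilinear_matrix_mult]
  bounded_bilinear.scaleR_left[OF bounded_bilinear_matrix_mult]
  bounded_bilinear.scaleR_right[OF bounded_bilinear_matrix_mult]
  bounded_bilinear.minus_left[OF bounded_bilinear_matrix_mult]
  bounded_bilinear.minus_right[OF bounded_bilinear_matrix_mult]

text \<open>Moving \<open>R\<close> across the inner product leaves
  \<open>transpose R ** R = mat 1\<close>. Thus \<open>R\<close>, and with it \<open>A\<close>, is
  bounded uniformly in time.\<close>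

lemma SO3_norm: "R \<in> SO3 \<Longrightarrow> norm R = norm (mat 1 :: real^3^3)"
  using inner_matrix_mult_left[of R R "mat 1"] inner_matrix_mult_left[of "mat 1" "mat 1" "mat 1"]
  by (simp add: SO3_def norm_eq_sqrt_inner)

lemma SO3_transpose_mult: "R \<in> SO3 \<Longrightarrow> transpose R ** R = mat 1"
  by (simp add: SO3_def)

lemma linear_transpose: "linear (transpose :: real^'n^'m \<Rightarrow> real^'m^'n)"
  by (rule linearI) (simp_all add: transpose_def vec_eq_iff)

text \<open>\<open>\<Omega>\<close> need not be continuous, so the observer equation itself is out of reach of Picard
  iteration. In the variable \<open>G = Abar R\<^sup>T\<close> the angular velocity cancels and the coefficients
  depend on \<open>t\<close> only through the continuous function \<open>R\<close>.\<close>

lemma observer_solution_exists: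
  assumes R: "rigid_body_kinematics R \<Omega>"
  obtains Abar bbar where
    "observer_solution kP kI (\<lambda>t. F ** R t) (\<lambda>t. \<Omega> t + b) Abar bbar" "Abar 0 = A0" "bbar 0 = b0"
proof -
  have SO: "R t \<in> SO3" if "0 \<le> t" for t
    using R that by (simp add: rigid_body_kinematics_def)
  have dR: "(R has_vector_derivative R t ** hat (\<Omega> t)) (at t within {0..})" if "0 \<le> t" for t
    using R that by (simp add: rigid_body_kinematics_def)
  have contR: "continuous_on {0..} R"
    using dR by (meson atLeast_iff continuous_on_eq_continuous_within has_vector_derivative_continuous)
  define r where "r = norm (mat 1 :: real^3^3)"
  \<comment> \<open>The state is \<open>G\<close> paired with \<open>bbar\<close>. Of
    \<open>hat (\<Omega> t + b)\<close> only the part from \<open>b\<close> survives, conjugated by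
    \<open>R t\<close>, and \<open>A t ** transpose (R t)\<close> is the constant
    \<open>F\<close>.\<close>
  define f where "f t x =
    (fst x ** (R t ** hat b ** transpose (R t)) - F ** (R t ** hat (snd x) ** transpose (R t))
       + kP *\<^sub>R (F - fst x),
     kI *\<^sub>R vee (Skew (transpose (F ** R t) ** (fst x ** R t))))"
    for t and x :: "(real^3^3) \<times> (real^3)"
  \<comment> \<open>One summand for each term of \<open>diff_f\<close>; the final 1 makes
    \<open>L\<close> positive in every case. Absolute values occur because the gains may have any
    sign here.\<close>
  define L where "L = r * norm (hat b) * r + norm F * (r * sqrt 2 * r) + \<bar>kP\<bar>
    + \<bar>kI\<bar> * (norm F * r * r) + 1"
  have r: "norm (R t) = r" if "0 \<le> t" for t
    using SO3_norm[OF SO[OF that]] by (simp add: r_def)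
  have r0: "0 \<le> r" by (simp add: r_def)
  have sandwich: "norm (R t ** M ** transpose (R t)) \<le> r * norm M * r" if "0 \<le> t" for t M
    using norm_matrix_mult_le[of "R t ** M" "transpose (R t)"]
      mult_right_mono[OF norm_matrix_mult_le[of "R t" M] r0]
    by (simp add: norm_transpose r[OF that])
  have L: "0 < L"
    unfolding L_def using r0 by (intro add_nonneg_pos add_nonneg_nonneg mult_nonneg_nonneg) auto
  \<comment> \<open>\<open>f t\<close> is affine, so the difference is its linear part at
    \<open>x - y\<close>.\<close>
  have diff_f: "f t x - f t y
    = (fst (x - y) ** (R t ** hat b ** transpose (R t))
         - F ** (R t ** hat (snd (x - y)) ** transpose (R t)) - kP *\<^sub>R fst (x - y),
       kI *\<^sub>R vee (Skew (transpose (F ** R t) ** (fst (x - y) ** R t))))" for t x y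
    by (simp add: f_def matrix_mult_bilinear_simps linear_diff[OF linear_hat]
        linear_diff[OF linear_vee_Skew] algebra_simps)
  have lip: "norm (f t x - f t y) \<le> L * norm (x - y)" if t: "0 \<le> t" for t x y
  proof -
    let ?z = "x - y"
    have n1: "norm (fst ?z) \<le> norm ?z" and n2: "norm (snd ?z) \<le> norm ?z"
      using norm_fst_le[of "fst ?z" "snd ?z"] norm_snd_le[of "snd ?z" "fst ?z"]
      unfolding prod.collapse by blast+
    have "norm (fst ?z ** (R t ** hat b ** transpose (R t))) \<le> norm ?z * (r * norm (hat b) * r)"
      by (rule order_trans[OF norm_matrix_mult_le]) (intro mult_mono n1 sandwich t, auto)
    moreover have "norm (F ** (R t ** hat (snd ?z) ** transpose (R t)))
        \<le> norm F * (r * (sqrt 2 * norm ?z) * r)"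
    proof (rule order_trans[OF norm_matrix_mult_le], intro mult_left_mono norm_ge_zero)
      have "r * norm (hat (snd ?z)) * r \<le> r * (sqrt 2 * norm ?z) * r"
        unfolding norm_hat using n2 r0 by (intro mult_left_mono mult_right_mono) auto
      then show "norm (R t ** hat (snd ?z) ** transpose (R t)) \<le> r * (sqrt 2 * norm ?z) * r"
        using sandwich[OF t] by (rule order_trans[rotated])
    qed
    moreover have "norm (kP *\<^sub>R fst ?z) \<le> \<bar>kP\<bar> * norm ?z"
      using n1 by (simp add: mult_left_mono)
    moreover have "norm (kI *\<^sub>R vee (Skew (transpose (F ** R t) ** (fst ?z ** R t))))
        \<le> \<bar>kI\<bar> * (norm F * r * (norm ?z * r))"
    proof -
      have "norm (vee (Skew (transpose (F ** R t) ** (fst ?z ** R t))))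
          \<le> norm (F ** R t) * norm (fst ?z ** R t)"
        using order_trans[OF norm_vee_Skew_le norm_matrix_mult_le, of "transpose (F ** R t)"]
        by (simp add: norm_transpose)
      also have "\<dots> \<le> (norm F * r) * (norm ?z * r)"
      proof (intro mult_mono)
        show "norm (F ** R t) \<le> norm F * r"
          using norm_matrix_mult_le[of F "R t"] r[OF t] by simp
        show "norm (fst ?z ** R t) \<le> norm ?z * r"
          using norm_matrix_mult_le[of "fst ?z" "R t"] r[OF t] mult_right_mono[OF n1 r0] by simp
      qed (use r0 in auto)
      finally show ?thesis by (simp add: mult_left_mono)
    qed
    ultimately have "norm (f t x - f t y) \<le> norm ?z * (r * norm (hat b) * r)
        + norm F * (r * (sqrt 2 * norm ?z) * r) + \<bar>kP\<bar> * norm ?z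
        + \<bar>kI\<bar> * (norm F * r * (norm ?z * r))"
      unfolding diff_f
      by (intro order_trans[OF norm_Pair_le] add_mono order_trans[OF norm_triangle_ineq4])
    also have "\<dots> = (L - 1) * norm ?z" by (simp add: L_def algebra_simps)
    also have "\<dots> \<le> L * norm ?z" by (intro mult_right_mono) auto
    finally show ?thesis .
  qed
  have bdd: "norm (f t 0) \<le> \<bar>kP\<bar> * norm F" for t
    by (simp add: f_def linear_0[OF linear_hat] linear_0[OF linear_vee_Skew] norm_Pair
        bounded_bilinear.zero_left[OF bounded_bilinear_matrix_mult]
        bounded_bilinear.zero_right[OF bounded_bilinear_matrix_mult])
  note mult_cont = bounded_bilinear.continuous_on[OF bounded_bilinear_matrix_mult]
  note lin_cont = bounded_linear.continuous_on[OF linear_conv_bounded_linear[THEN iffD1]]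
  have cont: "continuous_on ({0..} \<times> UNIV) (\<lambda>(t, x). f t x)"
  proof -
    have [continuous_intros]:
      "continuous_on ({0..} \<times> (UNIV :: ((real^3^3) \<times> (real^3)) set)) (\<lambda>p. R (fst p))"
      by (rule continuous_on_compose2[OF contR]) (auto intro!: continuous_intros)
    show ?thesis
      unfolding f_def case_prod_unfold
      by (intro continuous_intros mult_cont lin_cont[OF linear_hat] lin_cont[OF linear_transpose]
          lin_cont[OF linear_vee_Skew])
  qed
  \<comment> \<open>The initial value is that of \<open>G\<close>; multiplying by \<open>R 0\<close>
    returns \<open>A0\<close>.\<close>
  obtain x where x0: "x 0 = (A0 ** transpose (R 0), b0)"
    and dx: "\<And>t. 0 \<le> t \<Longrightarrow> (x has_vector_derivative f t (x t)) (at t within {0..})"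
    using global_lipschitz_ode_solution[OF cont lip bdd L] by blast
  define Abar where "Abar t = fst (x t) ** R t" for t
  define bbar where "bbar t = snd (x t)" for t
  show ?thesis
  proof
    show "Abar 0 = A0"
      using SO3_transpose_mult[OF SO[of 0]] by (simp add: Abar_def x0 flip: matrix_mul_assoc)
    show "bbar 0 = b0" by (simp add: bbar_def x0)
    show "observer_solution kP kI (\<lambda>t. F ** R t) (\<lambda>t. \<Omega> t + b) Abar bbar"
      unfolding observer_solution_def
    proof (intro conjI allI impI)
      fix t :: real assume t: "0 \<le> t"
      \<comment> \<open>The product rule brings the term with \<open>hat (\<Omega> t)\<close> back,
        and \<open>transpose (R t) ** R t = mat 1\<close> undoes the conjugations in
        \<open>f\<close>.\<close>
      have "((\<lambda>t. fst (x t) ** R t) has_vector_derivative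
          fst (x t) ** (R t ** hat (\<Omega> t)) + fst (f t (x t)) ** R t) (at t within {0..})"
        by (intro bounded_bilinear.has_vector_derivative[OF bounded_bilinear_matrix_mult]
            bounded_linear.has_vector_derivative[OF bounded_linear_fst] dx dR t)
      moreover have "fst (x t) ** (R t ** hat (\<Omega> t)) + fst (f t (x t)) ** R t
        = Abar t ** hat (\<Omega> t + b) - F ** R t ** hat (bbar t) + kP *\<^sub>R (F ** R t - Abar t)"
        using SO3_transpose_mult[OF SO[OF t]]
        by (simp add: f_def Abar_def bbar_def matrix_mult_bilinear_simps linear_add[OF linear_hat]
            algebra_simps flip: matrix_mul_assoc)
      ultimately show "(Abar has_vector_derivative
          Abar t ** hat (\<Omega> t + b) - F ** R t ** hat (bbar t) + kP *\<^sub>R (F ** R t - Abar t))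
          (at t within {0..})"
        by (simp add: Abar_def[abs_def])
      show "(bbar has_vector_derivative
          kI *\<^sub>R vee (Skew (transpose (F ** R t) ** Abar t))) (at t within {0..})"
        using bounded_linear.has_vector_derivative[OF bounded_linear_snd dx[OF t]]
        by (simp add: f_def Abar_def bbar_def[abs_def])
    qed
  qed
qed

section \<open>Derivative estimate for the Lyapunov function\<close>

lemma norm_mult_hat_le:
  assumes "norm A \<le> \<alpha>"
  shows "norm (A ** hat v) \<le> \<alpha> * (sqrt 2 * norm v)"
proof (rule order_trans[OF norm_matrix_mult_le])
  show "norm A * norm (hat v) \<le> \<alpha> * (sqrt 2 * norm v)"
    unfolding norm_hat by (rule mult_right_mono[OF assms]) simp
qed

text \<open>A pointwise inequality: \<open>dE\<close>, \<open>de\<close> and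
  \<open>A ** hat w\<close> stand for the derivatives of \<open>E\<close>, \<open>e\<close> and
  \<open>A\<close> at one instant, so the left side is the derivative of the modified
  \<open>V\<close>. The hypothesis \<open>small\<close> lets half of the dissipation
  \<open>kI * kP * |E|^2\<close> absorb the \<open>|E|^2\<close> terms that the cross term
  creates.\<close>

lemma lyapunov_derivative_le:
  fixes A E :: "real^3^3" and e :: "real^3"
  assumes A: "norm A \<le> \<alpha>" and H: "norm (hat w) \<le> \<beta>" and Hm: "norm (hat wm) \<le> \<beta>"
    and low: "\<gamma> * norm e \<le> norm (A ** hat e)" and \<gamma>: "0 < \<gamma>"
    and k: "0 < kP" "0 < kI" and \<epsilon>: "0 < \<epsilon>"
    and small: "\<epsilon> * (sqrt 2 * kI * \<alpha>^2 + ((2 * \<beta> + kP) * \<alpha> * sqrt 2)^2 / (2 * \<gamma>^2)) \<le> kI * kP / 2"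
    and dE: "dE = E ** hat wm - A ** hat e - kP *\<^sub>R E"
    and de: "de = kI *\<^sub>R vee (Skew (transpose A ** E))"
  shows "kI * inner E dE + 2 * inner e de
      + \<epsilon> * (inner dE (A ** hat e) + inner E (A ** hat w ** hat e + A ** hat de))
    \<le> - min (kI * kP / 2) (\<epsilon> * \<gamma>^2 / 2) * (norm E ^ 2 + norm e ^ 2)"
proof -
  define X where "X = norm E"
  define Y where "Y = norm e"
  \<comment> \<open>\<open>k1\<close> collects the coefficients of \<open>X * Y\<close> in
    \<open>t1\<close>, \<open>t2\<close> and \<open>t3\<close>; \<open>k2\<close> is the coefficient
    of \<open>X^2\<close> in \<open>t4\<close>.\<close>
  define k1 where "k1 = (2 * \<beta> + kP) * \<alpha> * sqrt 2"
  define k2 where "k2 = sqrt 2 * kI * \<alpha>^2"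
  have nn: "0 \<le> X" "0 \<le> Y" "0 \<le> \<alpha>" "0 \<le> \<beta>"
    using order_trans[OF norm_ge_zero A] order_trans[OF norm_ge_zero H] by (auto simp: X_def Y_def)
  note Ae = norm_mult_hat_le[OF A]
  have cross: "inner E (A ** hat e) = 2 * inner (vee (Skew (transpose A ** E))) e"
    by (simp add: inner_matrix_mult_left inner_hat_eq_vee_Skew)
  \<comment> \<open>The rotation term vanishes, and by \<open>cross\<close> the term
    \<open>A ** hat e\<close> cancels against \<open>inner e de\<close>; only the damping by
    \<open>kP\<close> is left.\<close>
  have energy: "kI * inner E dE + 2 * inner e de = - (kI * kP) * X^2"
    unfolding dE de X_def
    by (simp add: inner_diff_right inner_mult_hat_self cross power2_norm_eq_inner inner_commute
        algebra_simps)
  have t1: "inner (E ** hat wm) (A ** hat e) \<le> (X * \<beta>) * (\<alpha> * (sqrt 2 * Y))"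
  proof -
    have "norm (E ** hat wm) \<le> X * \<beta>"
      using norm_matrix_mult_le[of E "hat wm"] mult_left_mono[OF Hm nn(1)] by (simp add: X_def)
    then show ?thesis
      using norm_cauchy_schwarz[of "E ** hat wm" "A ** hat e"]
        mult_mono[OF _ Ae[of e], of "norm (E ** hat wm)" "X * \<beta>"] nn
      by (simp add: Y_def)
  qed
  have t2: "- kP * inner E (A ** hat e) \<le> kP * (X * (\<alpha> * (sqrt 2 * Y)))"
  proof -
    have "- inner E (A ** hat e) \<le> X * (\<alpha> * (sqrt 2 * Y))"
      using Cauchy_Schwarz_ineq2[of E "A ** hat e"] mult_left_mono[OF Ae[of e] nn(1)]
      by (simp add: X_def Y_def)
    then show ?thesis using mult_left_mono[of _ _ kP] k(1) by fastforce
  qed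
  have t3: "inner E (A ** hat w ** hat e) \<le> X * (\<alpha> * \<beta> * (sqrt 2 * Y))"
  proof -
    have "norm (A ** hat w ** hat e) \<le> (\<alpha> * \<beta>) * (sqrt 2 * Y)"
      by (rule order_trans[OF norm_matrix_mult_le], rule mult_mono,
          rule order_trans[OF norm_matrix_mult_le mult_mono[OF A H nn(3)]])
        (use nn in \<open>auto simp: norm_hat Y_def\<close>)
    then show ?thesis
      using norm_cauchy_schwarz[of E "A ** hat w ** hat e"]
        mult_left_mono[OF _ nn(1)] by (fastforce simp: X_def)
  qed
  have t4: "inner E (A ** hat de) \<le> k2 * X^2"
  proof -
    have "norm (vee (Skew (transpose A ** E))) \<le> \<alpha> * X"
      using norm_vee_Skew_le[of "transpose A ** E"] norm_matrix_mult_le[of "transpose A" E]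
        mult_right_mono[OF A nn(1)] by (simp add: norm_transpose X_def)
    then have "norm de \<le> kI * (\<alpha> * X)"
      using k(2) by (simp add: de mult_left_mono)
    then have "\<alpha> * (sqrt 2 * norm de) \<le> \<alpha> * (sqrt 2 * (kI * (\<alpha> * X)))"
      using nn by (intro mult_left_mono) auto
    then have "norm (A ** hat de) \<le> \<alpha> * (sqrt 2 * (kI * (\<alpha> * X)))"
      using Ae[of de] by linarith
    then have "X * norm (A ** hat de) \<le> X * (\<alpha> * (sqrt 2 * (kI * (\<alpha> * X))))"
      using nn(1) by (rule mult_left_mono)
    then show ?thesis
      using norm_cauchy_schwarz[of E "A ** hat de"]
      by (simp add: X_def k2_def power2_eq_square mult_ac)
  qed
  have t5: "\<gamma>^2 * Y^2 \<le> inner (A ** hat e) (A ** hat e)"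
    using power_mono[OF low, of 2] \<gamma> by (simp add: Y_def power_mult_distrib power2_norm_eq_inner)
  have "inner dE (A ** hat e) + inner E (A ** hat w ** hat e + A ** hat de)
      = inner (E ** hat wm) (A ** hat e) - inner (A ** hat e) (A ** hat e)
        + (- kP * inner E (A ** hat e)) + inner E (A ** hat w ** hat e) + inner E (A ** hat de)"
    by (simp add: dE inner_diff_left inner_add_right)
  also have "\<dots> \<le> k1 * (X * Y) - \<gamma>^2 * Y^2 + k2 * X^2"
    using t1 t2 t3 t4 t5 by (simp add: k1_def algebra_simps)
  \<comment> \<open>Young's inequality, weighted to use up exactly half of the available
    \<open>\<gamma>^2 * Y^2\<close>.\<close>
  also have "k1 * (X * Y) \<le> \<gamma>^2 / 2 * Y^2 + k1^2 / (2 * \<gamma>^2) * X^2"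
  proof -
    have "0 \<le> (\<gamma> * Y - k1 / \<gamma> * X)^2" by simp
    then show ?thesis using \<gamma> by (simp add: power2_eq_square field_simps)
  qed
  finally have "inner dE (A ** hat e) + inner E (A ** hat w ** hat e + A ** hat de)
      \<le> (k2 + k1^2 / (2 * \<gamma>^2)) * X^2 - \<gamma>^2 / 2 * Y^2"
    by (simp add: algebra_simps)
  then have "\<epsilon> * (inner dE (A ** hat e) + inner E (A ** hat w ** hat e + A ** hat de))
      \<le> \<epsilon> * ((k2 + k1^2 / (2 * \<gamma>^2)) * X^2 - \<gamma>^2 / 2 * Y^2)"
    using \<epsilon> by (intro mult_left_mono) auto
  also have "\<dots> = (\<epsilon> * (k2 + k1^2 / (2 * \<gamma>^2))) * X^2 - \<epsilon> * \<gamma>^2 / 2 * Y^2"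
    by (simp add: algebra_simps)
  also have "\<dots> \<le> kI * kP / 2 * X^2 - \<epsilon> * \<gamma>^2 / 2 * Y^2"
    using small by (intro diff_right_mono mult_right_mono) (auto simp: k1_def k2_def)
  finally have "kI * inner E dE + 2 * inner e de
      + \<epsilon> * (inner dE (A ** hat e) + inner E (A ** hat w ** hat e + A ** hat de))
    \<le> - (kI * kP / 2 * X^2 + \<epsilon> * \<gamma>^2 / 2 * Y^2)"
    unfolding energy by (simp add: field_simps)
  also have "\<dots> \<le> - (min (kI * kP / 2) (\<epsilon> * \<gamma>^2 / 2) * X^2 + min (kI * kP / 2) (\<epsilon> * \<gamma>^2 / 2) * Y^2)"
    by (intro le_imp_neg_le add_mono mult_right_mono) auto
  finally show ?thesis by (simp add: X_def Y_def algebra_simps)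
qed

section \<open>Exponential decay of the observer errors\<close>

text \<open>All constants are built from bounds on \<open>\<Omega>\<close>, from \<open>F\<close>,
  \<open>b\<close> and the gains before a solution is fixed, hence do not depend on initial values.
  The modified function \<open>W\<close> is comparable to \<open>N = |E|^2 + |e|^2\<close>, and
  \<open>W' \<le> - d * N\<close>.\<close>

lemma observer_error_decay:
  assumes R: "rigid_body_kinematics R \<Omega>" and bdd: "bounded (\<Omega> ` {0..})"
    and F: "invertible F" and k: "0 < kP" "0 < kI"
  obtains a C where "0 < a" "0 < C"
    and "\<And>Abar bbar t. observer_solution kP kI (\<lambda>t. F ** R t) (\<lambda>t. \<Omega> t + b) Abar bbar \<Longrightarrow> 0 \<le> t \<Longrightarrow>
      norm (F ** R t - Abar t) + norm (b - bbar t)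
        \<le> C * (norm (F ** R 0 - Abar 0) + norm (b - bbar 0)) * exp (- a * t)"
proof -
  have SO: "R t \<in> SO3" if "0 \<le> t" for t
    using R that by (simp add: rigid_body_kinematics_def)
  have dR: "(R has_vector_derivative R t ** hat (\<Omega> t)) (at t within {0..})" if "0 \<le> t" for t
    using R that by (simp add: rigid_body_kinematics_def)
  define r where "r = norm (mat 1 :: real^3^3)"
  have r: "norm (R t) = r" if "0 \<le> t" for t
    using SO3_norm[OF SO[OF that]] by (simp add: r_def)
  have rpos: "0 < r" by (simp add: r_def) (simp add: mat_def vec_eq_iff)
  obtain w where w: "\<And>t. 0 \<le> t \<Longrightarrow> norm (\<Omega> t) \<le> w"
    using bdd by (auto simp: bounded_iff)
  \<comment> \<open>One bound for both \<open>hat (\<Omega> t)\<close> and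
    \<open>hat (\<Omega> t + b)\<close>.\<close>
  define \<beta> where "\<beta> = sqrt 2 * (w + norm b)"
  have \<beta>1: "norm (hat (\<Omega> t)) \<le> \<beta>" if "0 \<le> t" for t
    using w[OF that] by (auto simp: norm_hat \<beta>_def intro!: mult_left_mono)
      (meson add_increasing2 norm_ge_zero)
  have \<beta>2: "norm (hat (\<Omega> t + b)) \<le> \<beta>" if "0 \<le> t" for t
    using norm_triangle_ineq[of "\<Omega> t" b] w[OF that]
    by (auto simp: norm_hat \<beta>_def intro!: mult_left_mono)
  define A where "A t = F ** R t" for t
  define \<alpha> where "\<alpha> = norm F * r"
  have \<alpha>: "norm (A t) \<le> \<alpha>" if "0 \<le> t" for t
    using norm_matrix_mult_le[of F "R t"] r[OF that] by (simp add: A_def \<alpha>_def)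
  have \<alpha>0: "0 \<le> \<alpha>" by (simp add: \<alpha>_def r_def)
  obtain G where G: "G ** F = mat 1" using F by (auto simp: invertible_def)
  then have "G \<noteq> 0"
    using rpos by (auto simp: r_def bounded_bilinear.zero_left[OF bounded_bilinear_matrix_mult])
  then have Gpos: "0 < norm G" by simp
  \<comment> \<open>Comes from \<open>hat v = transpose (R t) ** (G ** (A t ** hat v))\<close> by
    taking norms.\<close>
  define \<gamma> where "\<gamma> = sqrt 2 / (r * norm G)"
  have \<gamma>: "0 < \<gamma>" using rpos Gpos by (simp add: \<gamma>_def)
  have low: "\<gamma> * norm v \<le> norm (A t ** hat v)" if "0 \<le> t" for t v
  proof -
    have "transpose (R t) ** (G ** (A t ** hat v)) = transpose (R t) ** (G ** F) ** R t ** hat v"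
      by (simp add: A_def matrix_mul_assoc)
    also have "\<dots> = hat v" using SO3_transpose_mult[OF SO[OF that]] by (simp add: G)
    finally have "sqrt 2 * norm v = norm (transpose (R t) ** (G ** (A t ** hat v)))"
      by (simp add: norm_hat)
    also have "\<dots> \<le> r * (norm G * norm (A t ** hat v))"
      by (rule order_trans[OF norm_matrix_mult_le])
        (use rpos in \<open>simp add: norm_transpose r[OF that] norm_matrix_mult_le\<close>)
    finally show ?thesis using rpos Gpos by (simp add: \<gamma>_def field_simps)
  qed
  \<comment> \<open>The smaller coefficient of the form
    \<open>kI / 2 * |E|^2 + |e|^2\<close>.\<close>
  define m where "m = min (kI / 2) 1"
  have m: "0 < m" "m \<le> kI / 2" "m \<le> 1" using k by (auto simp: m_def)
  define \<kappa> where "\<kappa> = sqrt 2 * kI * \<alpha>^2 + ((2 * \<beta> + kP) * \<alpha> * sqrt 2)^2 / (2 * \<gamma>^2)"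
  have \<kappa>: "0 \<le> \<kappa>" using k by (simp add: \<kappa>_def)
  \<comment> \<open>The first bound keeps the cross term below half of the unmodified form, so that
    \<open>W\<close> stays coercive; the second is the smallness required for the derivative
    estimate. The added 1 keeps the denominators positive.\<close>
  define \<epsilon> where "\<epsilon> = min (m / 2 / (\<alpha> + 1)) (kI * kP / 2 / (\<kappa> + 1))"
  have \<epsilon>: "0 < \<epsilon>" using m k \<alpha>0 \<kappa> by (simp add: \<epsilon>_def)
  have \<epsilon>\<alpha>: "\<epsilon> * \<alpha> \<le> m / 2"
  proof -
    have "\<epsilon> * (\<alpha> + 1) \<le> m / 2 / (\<alpha> + 1) * (\<alpha> + 1)"
      using \<alpha>0 by (intro mult_right_mono) (auto simp: \<epsilon>_def)
    also have "\<dots> = m / 2" using \<alpha>0 by (simp add: field_simps)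
    finally have "\<epsilon> * (\<alpha> + 1) \<le> m / 2" .
    then show ?thesis using \<alpha>0 \<epsilon> by (simp add: distrib_left)
  qed
  have \<epsilon>\<kappa>: "\<epsilon> * \<kappa> \<le> kI * kP / 2"
  proof -
    have "\<epsilon> * (\<kappa> + 1) \<le> kI * kP / 2 / (\<kappa> + 1) * (\<kappa> + 1)"
      using \<kappa> by (intro mult_right_mono) (auto simp: \<epsilon>_def)
    also have "\<dots> = kI * kP / 2" using \<kappa> by (simp add: field_simps)
    finally have "\<epsilon> * (\<kappa> + 1) \<le> kI * kP / 2" .
    then show ?thesis using \<kappa> \<epsilon> by (simp add: distrib_left)
  qed
  define d where "d = min (kI * kP / 2) (\<epsilon> * \<gamma>^2 / 2)"
  have d: "0 < d" using k \<epsilon> \<gamma> by (simp add: d_def)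
  \<comment> \<open>\<open>kI + 1\<close> bounds the unmodified form and 1 the cross term. Then
    \<open>W \<le> M * N\<close> turns \<open>- d * N\<close> into \<open>- c * W\<close> with
    \<open>c = d / M\<close>.\<close>
  define M where "M = kI + 2"
  have M: "0 < M" using k by (simp add: M_def)
  define c where "c = d / M"
  have c: "0 < c" using d M by (simp add: c_def)
  show ?thesis
  proof
    \<comment> \<open>Taking the square root of the decay of \<open>N\<close> halves the rate. In
      \<open>4 * M / m\<close> one factor 2 comes from the lower bound \<open>m / 2 * N\<close>, the
      other from \<open>(x + y)^2 \<le> 2 * (x^2 + y^2)\<close>.\<close>
    show "0 < c / 2" using c by simp
    show "0 < sqrt (4 * M / m)" using M m by simp
    fix Abar bbar t
    assume sol: "observer_solution kP kI (\<lambda>t. F ** R t) (\<lambda>t. \<Omega> t + b) Abar bbar"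
      and t: "0 \<le> (t::real)"
    define E where "E t = A t - Abar t" for t
    define e where "e t = b - bbar t" for t
    define dE where "dE t = E t ** hat (\<Omega> t + b) - A t ** hat (e t) - kP *\<^sub>R E t" for t
    define de where "de t = kI *\<^sub>R vee (Skew (transpose (A t) ** E t))" for t
    define N where "N t = norm (E t) ^ 2 + norm (e t) ^ 2" for t
    define W where "W t = kI / 2 * inner (E t) (E t) + inner (e t) (e t)
      + \<epsilon> * inner (E t) (A t ** hat (e t))" for t
    define W' where "W' t = kI * inner (E t) (dE t) + 2 * inner (e t) (de t)
      + \<epsilon> * (inner (dE t) (A t ** hat (e t))
        + inner (E t) (A t ** hat (\<Omega> t) ** hat (e t) + A t ** hat (de t)))" for t
    have dA: "(A has_vector_derivative A t ** hat (\<Omega> t)) (at t within {0..})" if "0 \<le> t" for t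
      unfolding A_def[abs_def] matrix_mul_assoc[symmetric]
      by (rule bounded_linear.has_vector_derivative[OF
            bounded_bilinear.bounded_linear_right[OF bounded_bilinear_matrix_mult] dR[OF that]])
    have dE: "(E has_vector_derivative dE t) (at t within {0..})" if "0 \<le> t" for t
    proof -
      \<comment> \<open>Here \<open>A t ** hat (\<Omega> t)\<close> equals
        \<open>A t ** hat (\<Omega> t + b) - A t ** hat b\<close>, and the last term combines with
        \<open>bbar\<close> to give \<open>e\<close>.\<close>
      have "(E has_vector_derivative A t ** hat (\<Omega> t)
          - (Abar t ** hat (\<Omega> t + b) - A t ** hat (bbar t) + kP *\<^sub>R (A t - Abar t))) (at t within {0..})"
        unfolding E_def[abs_def] using sol that
        by (intro has_vector_derivative_diff dA) (auto simp: observer_solution_def A_def)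
      then show ?thesis
        by (simp add: dE_def E_def e_def matrix_mult_bilinear_simps linear_add[OF linear_hat]
            linear_diff[OF linear_hat] algebra_simps)
    qed
    have de: "(e has_vector_derivative de t) (at t within {0..})" if "0 \<le> t" for t
    proof -
      have "(e has_vector_derivative 0 - kI *\<^sub>R vee (Skew (transpose (A t) ** Abar t))) (at t within {0..})"
        unfolding e_def[abs_def] using sol that
        by (intro has_vector_derivative_diff has_vector_derivative_const)
          (auto simp: observer_solution_def A_def)
      \<comment> \<open>As \<open>transpose (A t) ** A t\<close> is symmetric, replacing
        \<open>Abar\<close> by \<open>E\<close> inside \<open>Skew\<close> only flips the
        sign.\<close>
      moreover have "Skew (transpose (A t) ** A t) = 0"
        by (simp add: Skew_def matrix_transpose_mul)
      then have "vee (Skew (transpose (A t) ** A t)) = 0"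
        using vee_hat[of 0] by (simp add: linear_0[OF linear_hat])
      ultimately show ?thesis
        by (simp add: de_def E_def matrix_mult_bilinear_simps linear_diff[OF linear_vee_Skew])
    qed
    have dW: "(W has_real_derivative W' t) (at t within {0..})" if "0 \<le> t" for t
    proof -
      note inner_deriv = bounded_bilinear.has_vector_derivative[OF bounded_bilinear_inner]
      have dhat: "((\<lambda>t. hat (e t)) has_vector_derivative hat (de t)) (at t within {0..})"
        by (rule bounded_linear.has_vector_derivative[OF
              linear_conv_bounded_linear[THEN iffD1, OF linear_hat] de[OF that]])
      have dAe: "((\<lambda>t. A t ** hat (e t)) has_vector_derivative
          A t ** hat (de t) + A t ** hat (\<Omega> t) ** hat (e t)) (at t within {0..})"
        by (rule bounded_bilinear.has_vector_derivative[OF bounded_bilinear_matrix_mult dA[OF that] dhat])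
      have "(W has_real_derivative
          kI / 2 * (inner (E t) (dE t) + inner (dE t) (E t)) + (inner (e t) (de t) + inner (de t) (e t))
          + \<epsilon> * (inner (E t) (A t ** hat (de t) + A t ** hat (\<Omega> t) ** hat (e t))
                + inner (dE t) (A t ** hat (e t)))) (at t within {0..})"
        unfolding W_def[abs_def]
        by (intro DERIV_add DERIV_cmult inner_deriv[OF dE dE, THEN has_real_derivative_iff_has_vector_derivative[THEN iffD2]]
          inner_deriv[OF de de, THEN has_real_derivative_iff_has_vector_derivative[THEN iffD2]]
          inner_deriv[OF dE dAe, THEN has_real_derivative_iff_has_vector_derivative[THEN iffD2]] that)
      then show ?thesis
        by (simp add: W'_def inner_commute inner_add_right add_ac)
    qed
    have cross: "\<bar>\<epsilon> * inner (E t) (A t ** hat (e t))\<bar> \<le> m / 2 * N t" if "0 \<le> t" for t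
    proof -
      have "\<bar>inner (E t) (A t ** hat (e t))\<bar> \<le> norm (E t) * (\<alpha> * (sqrt 2 * norm (e t)))"
      proof -
        have "norm (A t ** hat (e t)) \<le> \<alpha> * (sqrt 2 * norm (e t))"
          by (rule norm_mult_hat_le[OF \<alpha>[OF that]])
        then show ?thesis
          using Cauchy_Schwarz_ineq2[of "E t" "A t ** hat (e t)"]
          by (meson mult_left_mono norm_ge_zero order_trans)
      qed
      \<comment> \<open>Rounding \<open>sqrt 2\<close> up to 2 prepares for
        \<open>2 * x * y \<le> x^2 + y^2\<close>.\<close>
      also have "\<dots> \<le> norm (E t) * (\<alpha> * (2 * norm (e t)))"
        using \<alpha>0 sqrt2_less_2 by (intro mult_left_mono mult_right_mono) auto
      also have "\<dots> \<le> \<alpha> * N t"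
      proof -
        have "2 * norm (E t) * norm (e t) \<le> N t"
          unfolding N_def by (rule sum_squares_bound)
        from mult_left_mono[OF this \<alpha>0] show ?thesis by (simp add: mult_ac)
      qed
      finally have "\<epsilon> * \<bar>inner (E t) (A t ** hat (e t))\<bar> \<le> \<epsilon> * (\<alpha> * N t)"
        using \<epsilon> by (intro mult_left_mono) auto
      also have "\<dots> \<le> m / 2 * N t"
        using mult_right_mono[OF \<epsilon>\<alpha>, of "N t"] by (simp add: N_def mult.assoc)
      finally show ?thesis using \<epsilon> by (simp add: abs_mult)
    qed
    have Wlow: "m / 2 * N t \<le> W t" and Wup: "W t \<le> M * N t" if "0 \<le> t" for t
    proof -
      have n: "0 \<le> norm (E t)^2" "0 \<le> norm (e t)^2" by auto
      have W: "W t = kI / 2 * norm (E t)^2 + norm (e t)^2 + \<epsilon> * inner (E t) (A t ** hat (e t))"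
        by (simp add: W_def power2_norm_eq_inner)
      have "m * norm (E t)^2 \<le> kI / 2 * norm (E t)^2" "m * norm (e t)^2 \<le> 1 * norm (e t)^2"
        using m n by (simp_all only: mult_right_mono)
      then show "m / 2 * N t \<le> W t"
        using cross[OF that] unfolding W by (simp add: N_def algebra_simps abs_le_iff)
      have "m / 2 * N t \<le> 1 * N t"
        using m by (intro mult_right_mono) (auto simp: N_def)
      moreover have "kI / 2 * norm (E t)^2 + norm (e t)^2 \<le> (kI + 1) * N t"
      proof -
        have "kI / 2 \<le> kI + 1" "1 \<le> kI + 1" using k by auto
        from this[THEN mult_right_mono] n
        have "kI / 2 * norm (E t)^2 \<le> (kI + 1) * norm (E t)^2" "1 * norm (e t)^2 \<le> (kI + 1) * norm (e t)^2"
          by blast+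
        then show ?thesis by (simp add: N_def algebra_simps)
      qed
      ultimately show "W t \<le> M * N t"
        using cross[OF that] unfolding W M_def by (simp add: algebra_simps abs_le_iff)
    qed
    have "W' t \<le> - c * W t" if "0 \<le> t" for t
    proof -
      have "W' t \<le> - d * N t"
        unfolding W'_def d_def N_def
        by (rule lyapunov_derivative_le[OF \<alpha>[OF that] \<beta>1[OF that] \<beta>2[OF that] low[OF that] \<gamma> k \<epsilon>
              \<epsilon>\<kappa>[unfolded \<kappa>_def] dE_def de_def])
      moreover have "c * W t \<le> c * (M * N t)"
        using c Wup[OF that] by (intro mult_left_mono) auto
      ultimately show ?thesis using M by (simp add: c_def)
    qed
    from decay_from_derivative_bound[OF dW this t]
    have "W t \<le> W 0 * exp (- c * t)" .
    also have "\<dots> \<le> M * N 0 * exp (- c * t)"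
      by (intro mult_right_mono Wup) auto
    finally have "m / 2 * N t \<le> M * N 0 * exp (- c * t)" using Wlow[OF t] by linarith
    then have Nt: "2 * N t \<le> 4 * M / m * (N 0 * exp (- c * t))"
      using m by (simp add: field_simps)
    have "(norm (E t) + norm (e t))^2 \<le> 2 * N t"
      using sum_squares_bound[of "norm (E t)" "norm (e t)"] by (simp add: N_def power2_sum)
    also note Nt
    also have "4 * M / m * (N 0 * exp (- c * t))
        \<le> 4 * M / m * ((norm (E 0) + norm (e 0))^2 * exp (- c * t))"
      using M m by (intro mult_left_mono mult_right_mono) (auto simp: N_def power2_sum)
    also have "exp (- c * t) = exp (- (c / 2) * t) ^ 2"
      by (simp flip: exp_double)
    also have "4 * M / m * ((norm (E 0) + norm (e 0))^2 * exp (- (c / 2) * t) ^ 2)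
        = (sqrt (4 * M / m) * (norm (E 0) + norm (e 0)) * exp (- (c / 2) * t))^2"
      using M m by (simp add: power_mult_distrib)
    finally have "norm (E t) + norm (e t)
        \<le> sqrt (4 * M / m) * (norm (E 0) + norm (e 0)) * exp (- (c / 2) * t)"
      using M m by (elim power2_le_imp_le) (intro mult_nonneg_nonneg add_nonneg_nonneg, auto)
    then show "norm (F ** R t - Abar t) + norm (b - bbar t)
        \<le> sqrt (4 * M / m) * (norm (F ** R 0 - Abar 0) + norm (b - bbar 0)) * exp (- (c / 2) * t)"
      by (simp add: E_def e_def A_def)
  qed
qed

theorem theorem2p4:
  fixes R :: "real \<Rightarrow> real^3^3" and \<Omega> :: "real \<Rightarrow> real^3"
    and b :: "real^3" and F :: "real^3^3" and kP kI :: real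
  assumes "rigid_body_kinematics R \<Omega>"
    and "bounded (\<Omega> ` {0..})"
    and "invertible F"
    and "kP > 0" and "kI > 0"
  defines "\<Omega>m \<equiv> \<lambda>t. \<Omega> t + b"
    and "A \<equiv> \<lambda>t. F ** R t"
  shows "\<exists>a>0. \<exists>C>0. \<forall>A0 b0.
    (\<exists>Abar bbar. observer_solution kP kI A \<Omega>m Abar bbar \<and> Abar 0 = A0 \<and> bbar 0 = b0) \<and>
    (\<forall>Abar bbar. observer_solution kP kI A \<Omega>m Abar bbar \<and> Abar 0 = A0 \<and> bbar 0 = b0 \<longrightarrow>
      (\<forall>t\<ge>0. norm (A t - Abar t) + norm (b - bbar t)
        \<le> C * (norm (A 0 - Abar 0) + norm (b - bbar 0)) * exp (- a * t)))"
proof -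
  obtain a C where "0 < a" "0 < C"
    and "\<And>Abar bbar t. observer_solution kP kI A \<Omega>m Abar bbar \<Longrightarrow> 0 \<le> t \<Longrightarrow>
      norm (A t - Abar t) + norm (b - bbar t)
        \<le> C * (norm (A 0 - Abar 0) + norm (b - bbar 0)) * exp (- a * t)"
    unfolding A_def \<Omega>m_def by (rule observer_error_decay[OF assms(1-5), of b]) blast
  \<comment> \<open>Existence for each initial value keeps the decay bound from being
    vacuous.\<close>
  moreover have "\<exists>Abar bbar. observer_solution kP kI A \<Omega>m Abar bbar \<and> Abar 0 = A0 \<and> bbar 0 = b0"
    for A0 b0
    unfolding A_def \<Omega>m_def by (rule observer_solution_exists[OF assms(1)]) blast
  ultimately show ?thesis by blast
qed

end
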